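(* Let $m\ge 1$ and let $Q$ be an acyclic quiver whose underlying undirected graph is an extended Dynkin diagram of type $\widetilde{\mathbb A}_m$ (that is, a cycle with $m+1$ vertices). Then the frieze associated to $Q$ is $\mathbb N$-rational, i.e. for each vertex $v$ of $Q$ the sequence $(a(v,n))_{n\ge0}$ is $\mathbb N$-rational.
   Context: $\widetilde{\mathbb A}_m$ ($m\ge 1$) is the cycle with $m+1$ vertices; for $m=1$ it is two vertices joined by a double edge. A quiver is a directed graph; it is acyclic if it has no directed cycle. For a finite acyclic quiver $Q$ with vertex set $V$, the frieze associated to $Q$ is the family of sequences $(a(v,n))_{n\ge 0}$, $v\in V$, defined by $a(v,0)=1$ and $$a(v,n+1)=\frac{1+\prod_{w\to v}a(w,n+1)\prod_{v\to w}a(w,n)}{a(v,n)},$$ where the products run over the arrows of $Q$ ending at $v$, respectively starting at $v$, counted with multiplicity. A sequence $(a_n)_{n\ge0}$ of natural numbers is $\mathbb N$-rational if there exist $d\ge1$ and matrices $\lambda\in\mathbb N^{1\times d}$, $M\in\mathbb N^{d\times d}$, $\gamma\in\mathbb N^{d\times 1}$ such that $a_n=\lambda M^n\gamma$ for all $n\in\mathbb N$. *)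

theory Defs
  imports "Jordan_Normal_Form.Matrix" "Graph_Theory.Arc_Walk"
begin

text \<open>
  A quiver is a directed multigraph: parallel arcs are distinct elements of \<^term>\<open>arcs Q\<close>.
  A loop is a directed cycle of length one, so acyclicity excludes loops.
\<close>

locale acyclic_quiver = fin_digraph Q for Q :: "('v, 'e) pre_digraph" (structure) +
  assumes no_directed_cycle: "\<nexists>p. cycle p"
begin

lemma wf_arcs_ends: "wf (arcs_ends Q)"
proof (rule finite_acyclic_wf)
  show "finite (arcs_ends Q)"
    by (simp add: arcs_ends_def)
  show "acyclic (arcs_ends Q)"
  proof (rule acyclicI, intro allI notI)
    fix u assume "(u, u) \<in> (arcs_ends Q)\<^sup>+"
    then obtain p where "awalk u p u" "p \<noteq> []"
      using reachable1_awalk by blast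
    then have "closed_w p"
      by (auto simp: closed_w_def)
    with no_directed_cycle show False
      using closed_w_imp_cycle by blast
  qed
qed

text \<open>
  Products over arcs count multiplicities. The values are a priori only rational numbers.
\<close>

function frieze :: "'v \<Rightarrow> nat \<Rightarrow> rat" where
  "frieze v 0 = 1"
| "frieze v (Suc n) =
     (1 + (\<Prod>e\<in>in_arcs Q v. frieze (tail Q e) (Suc n)) *
          (\<Prod>e\<in>out_arcs Q v. frieze (head Q e) n)) / frieze v n"
  by pat_completeness auto
termination
proof (relation "inv_image (less_than <*lex*> arcs_ends Q) (\<lambda>(v, n). (n, v))")
  show "wf (inv_image (less_than <*lex*> arcs_ends Q) (\<lambda>(v, n). (n, v)))"
    using wf_arcs_ends by blast
qed (auto simp: arcs_ends_conv in_arcs_def)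

end

text \<open>
  The underlying undirected multigraph is a cycle with vertices \<open>\<phi> 0, \<dots>, \<phi> m\<close> and edges
  \<open>\<psi> 0, \<dots>, \<psi> m\<close>, the edge \<open>\<psi> i\<close> joining \<open>\<phi> i\<close> and \<open>\<phi> (i + 1)\<close> (indices modulo \<open>m + 1\<close>).
  As the edges are enumerated bijectively, \<open>m = 1\<close> gives two vertices joined by a double edge.
\<close>

definition underlying_A_tilde :: "nat \<Rightarrow> ('v, 'e) pre_digraph \<Rightarrow> bool" where
  "underlying_A_tilde m Q \<longleftrightarrow>
     (\<exists>\<phi> \<psi>. bij_betw \<phi> {0..m} (verts Q) \<and> bij_betw \<psi> {0..m} (arcs Q) \<and>
       (\<forall>i\<in>{0..m}. {tail Q (\<psi> i), head Q (\<psi> i)} = {\<phi> i, \<phi> ((i + 1) mod (m + 1))}))"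

definition N_rational :: "(nat \<Rightarrow> nat) \<Rightarrow> bool" where
  "N_rational a \<longleftrightarrow>
     (\<exists>d\<ge>1. \<exists>\<Lambda> \<in> carrier_mat 1 d. \<exists>M \<in> carrier_mat d d. \<exists>\<Gamma> \<in> carrier_mat d 1.
       \<forall>n. a n = (\<Lambda> * (M ^\<^sub>m n) * \<Gamma>) $$ (0, 0))"

end

theory Submission
  imports Defs
begin

text \<open>
  Unroll the cycle to a bi-infinite path and give the edge between \<open>i\<close> and \<open>i + 1\<close> the matrix
  \<open>X = (1 1; 0 1)\<close> if its arrow points to \<open>i + 1\<close> (a forward edge), and \<open>Y = (1 0; 1 1)\<close>
  if it points to \<open>i\<close> (a backward edge). Both kinds of edges occur, because the quiver is
  acyclic. Let \<open>L\<^sub>n(i)\<close> be the row vector \<open>(0 1)\<close> times the product of the matrices along the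
  path that ends at \<open>i\<close> and is long enough to contain exactly \<open>n\<close> backward edges, and let
  \<open>R\<^sub>n(i)\<close> be the product along the path that starts at \<open>i\<close> and contains exactly \<open>n\<close> forward
  edges, times the column vector \<open>(0 1)\<close>. These are well defined, since \<open>X\<close> fixes the row
  \<open>(0 1)\<close> and \<open>Y\<close> fixes the column \<open>(0 1)\<close>. The frieze is
  \<open>a(i, n) = L\<^sub>n(i) R\<^sub>n(i)\<close>.

  Indeed, moving one edge along the path transfers one matrix from one factor to the other, so
  the left neighbour of \<open>i\<close> in the frieze rule is \<open>L\<^sub>n\<^sub>+\<^sub>1(i) R\<^sub>n(i)\<close> and the right one is
  \<open>L\<^sub>n(i) R\<^sub>n\<^sub>+\<^sub>1(i)\<close>, whatever the directions of the arrows
  (\<open>pairing_fwd\<close>, \<open>pairing_not_fwd\<close>). The frieze rule then says that the determinant of the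
  \<open>2 \<times> 2\<close> matrix with entries \<open>L\<^sub>j(i) R\<^sub>k(i)\<close>, where \<open>j\<close> and \<open>k\<close> range over \<open>n\<close> and \<open>n + 1\<close>,
  is \<open>1\<close>. This determinant is the product of the determinants of
  \<open>(L\<^sub>n(i), L\<^sub>n\<^sub>+\<^sub>1(i))\<close> and \<open>(R\<^sub>n(i), R\<^sub>n\<^sub>+\<^sub>1(i))\<close>, both of which are \<open>-1\<close> because \<open>X\<close> and
  \<open>Y\<close> have determinant \<open>1\<close> (\<open>ray_det\<close>, \<open>pairing_unimodular\<close>).

  Finally, \<open>L\<^sub>n\<^sub>+\<^sub>1\<close> at a vertex is obtained from \<open>L\<^sub>n\<close> at the vertex behind the nearest
  backward edge by multiplication with a nonnegative matrix. Hence the finitely many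
  coordinates of all the \<open>L\<^sub>n(i)\<close> form a linear system with coefficients in \<open>\<nat>\<close>; so do
  those of the \<open>R\<^sub>n(i)\<close>, and so do the products of a coordinate of the first kind with one of
  the second. The frieze is a sum of such products, so it is \<open>\<nat>\<close>-rational
  (\<open>N_rational_linear_system\<close>).
\<close>

section \<open>Linear systems with natural coefficients\<close>

text \<open>
  The coefficients do not depend on \<open>n\<close>. Membership of the shifted sequences \<open>B i (n + 1)\<close>
  therefore expresses that the family \<open>B\<close> is driven by one constant matrix over \<open>\<nat>\<close>.
\<close>
definition nat_combs :: "'i set \<Rightarrow> ('i \<Rightarrow> nat \<Rightarrow> nat) \<Rightarrow> (nat \<Rightarrow> nat) set" where
  "nat_combs I B = {f. \<exists>c. \<forall>n. f n = (\<Sum>i\<in>I. c i * B i n)}"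

lemma nat_combs_base:
  assumes "finite I" "i \<in> I"
  shows "B i \<in> nat_combs I B"
proof -
  have "\<forall>n. B i n = (\<Sum>j\<in>I. (if j = i then 1 else 0) * B j n)"
    using assms by (simp add: if_distrib[of "\<lambda>x. x * _"] cong: if_cong)
  then show ?thesis
    unfolding nat_combs_def by (intro CollectI exI)
qed

lemma nat_combs_add:
  assumes "f \<in> nat_combs I B" "g \<in> nat_combs I B"
  shows "(\<lambda>n. f n + g n) \<in> nat_combs I B"
proof -
  obtain c d where "\<forall>n. f n = (\<Sum>i\<in>I. c i * B i n)" "\<forall>n. g n = (\<Sum>i\<in>I. d i * B i n)"
    using assms by (auto simp: nat_combs_def)
  then have "\<forall>n. f n + g n = (\<Sum>i\<in>I. (c i + d i) * B i n)"
    by (simp add: algebra_simps sum.distrib)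
  then show ?thesis
    unfolding nat_combs_def by (intro CollectI exI)
qed

text \<open>
  On transition matrices this is the Kronecker product: two linear systems give one for
  the products of their components.
\<close>
lemma nat_combs_mult:
  assumes "f \<in> nat_combs I B" "g \<in> nat_combs J C"
  shows "(\<lambda>n. f n * g n) \<in> nat_combs (I \<times> J) (\<lambda>(i, j) n. B i n * C j n)"
proof -
  obtain c d where "\<forall>n. f n = (\<Sum>i\<in>I. c i * B i n)" "\<forall>n. g n = (\<Sum>j\<in>J. d j * C j n)"
    using assms by (auto simp: nat_combs_def)
  then have "\<forall>n. f n * g n =
      (\<Sum>p\<in>I \<times> J. (c (fst p) * d (snd p)) * (\<lambda>(i, j) n. B i n * C j n) p n)"
    by (simp add: sum_product sum.cartesian_product case_prod_beta algebra_simps)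
  then show ?thesis
    unfolding nat_combs_def by (intro CollectI exI)
qed

text \<open>
  The transition coefficients of the system form \<open>M\<close>, the initial values form \<open>\<Gamma>\<close>, and the
  coefficients expressing \<open>f\<close> form \<open>\<Lambda>\<close>: then \<open>M\<^sup>n \<Gamma>\<close> is the column of the values at \<open>n\<close>.
\<close>
lemma N_rational_linear_system:
  assumes fin: "finite I" and ne: "I \<noteq> {}"
    and step: "\<And>i. i \<in> I \<Longrightarrow> (\<lambda>n. B i (Suc n)) \<in> nat_combs I B"
    and f: "f \<in> nat_combs I B"
  shows "N_rational f"
proof -
  obtain l where l: "\<And>n. f n = (\<Sum>i\<in>I. l i * B i n)"
    using f by (auto simp: nat_combs_def)
  have "\<forall>i\<in>I. \<exists>c. \<forall>n. B i (Suc n) = (\<Sum>j\<in>I. c j * B j n)"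
    using step by (auto simp: nat_combs_def)
  then obtain c where c: "\<And>i n. i \<in> I \<Longrightarrow> B i (Suc n) = (\<Sum>j\<in>I. c i j * B j n)"
    by metis
  define d where "d = card I"
  obtain h where h: "bij_betw h {0..<d} I"
    using ex_bij_betw_nat_finite[OF fin] by (auto simp: d_def)
  have d: "d \<ge> 1"
    using fin ne by (simp add: d_def Suc_le_eq card_gt_0_iff)
  have h_in: "h i \<in> I" if "i < d" for i
    using h that by (auto simp: bij_betw_def)
  have reindex: "(\<Sum>i = 0..<d. g (h i)) = (\<Sum>i\<in>I. g i)" for g :: "_ \<Rightarrow> nat"
    by (rule sum.reindex_bij_betw[OF h])
  define \<Lambda> where "\<Lambda> = mat 1 d (\<lambda>(_, j). l (h j))"
  define M where "M = mat d d (\<lambda>(i, j). c (h i) (h j))"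
  define \<Gamma> where "\<Gamma> k = mat d 1 (\<lambda>(i, _). B (h i) k)" for k
  have carr: "\<Lambda> \<in> carrier_mat 1 d" "M \<in> carrier_mat d d" "\<And>k. \<Gamma> k \<in> carrier_mat d 1"
    by (auto simp: \<Lambda>_def M_def \<Gamma>_def)
  have pow: "M ^\<^sub>m n \<in> carrier_mat d d" for n
    using carr by simp
  have M_\<Gamma>: "M * \<Gamma> k = \<Gamma> (Suc k)" for k
    by (rule eq_matI)
      (auto simp: M_def \<Gamma>_def scalar_prod_def c[OF h_in] reindex[symmetric])
  \<comment> \<open>Powers of matrices grow on the right, so the induction has to move the starting point \<open>k\<close>.\<close>
  have "(M ^\<^sub>m n) * \<Gamma> k = \<Gamma> (n + k)" for n k
  proof (induction n arbitrary: k)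
    case 0
    then show ?case using left_mult_one_mat[OF carr(3)] by (simp add: M_def)
  next
    case (Suc n)
    have "M ^\<^sub>m Suc n * \<Gamma> k = M ^\<^sub>m n * (M * \<Gamma> k)"
      using assoc_mult_mat[OF pow carr(2) carr(3)] by simp
    then show ?case
      using Suc.IH[of "Suc k"] by (simp add: M_\<Gamma>)
  qed
  then have "\<Lambda> * (M ^\<^sub>m n) * \<Gamma> 0 = \<Lambda> * \<Gamma> n" for n
    using assoc_mult_mat[OF carr(1) pow carr(3)] by simp
  moreover have "(\<Lambda> * \<Gamma> n) $$ (0, 0) = f n" for n
    by (simp add: \<Lambda>_def \<Gamma>_def scalar_prod_def l reindex[symmetric])
  ultimately show ?thesis
    unfolding N_rational_def using d carr by metis
qed

section \<open>Pairs of natural numbers moved by two shears\<close>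

text \<open>
  On row vectors these are the right multiplications by \<open>X\<close> and \<open>Y\<close>; on column vectors they
  are the left multiplications by \<open>Y\<close> and \<open>X\<close>. This is why one recursion serves for both
  vectors \<open>L\<^sub>n(i)\<close> and \<open>R\<^sub>n(i)\<close>.
\<close>
definition shear_snd :: "nat \<times> nat \<Rightarrow> nat \<times> nat" where
  "shear_snd p = (fst p, fst p + snd p)"

definition shear_fst :: "nat \<times> nat \<Rightarrow> nat \<times> nat" where
  "shear_fst p = (fst p + snd p, snd p)"

lemma shear_sel [simp]:
  "fst (shear_snd p) = fst p" "snd (shear_snd p) = fst p + snd p"
  "fst (shear_fst p) = fst p + snd p" "snd (shear_fst p) = snd p"
  by (simp_all add: shear_snd_def shear_fst_def)

text \<open>
  A walk \<open>v, \<sigma> v, \<sigma> (\<sigma> v), \<dots>\<close> whose steps are of two kinds. A step from a vertex \<open>v\<close> with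
  \<open>same v\<close> keeps the index \<open>n\<close>, the other steps lower it; well-foundedness says that a walk in
  \<open>V\<close> cannot consist of index-keeping steps only, so that the recursion below ends.
\<close>
locale shear_recursion =
  fixes V :: "'v set" and \<sigma> :: "'v \<Rightarrow> 'v" and same :: "'v \<Rightarrow> bool"
  assumes finite_V: "finite V"
    and \<sigma>_closed: "v \<in> V \<Longrightarrow> \<sigma> v \<in> V"
    and wf_same: "wf {(\<sigma> v, v) | v. v \<in> V \<and> same v}"
begin

function ray :: "'v \<Rightarrow> nat \<Rightarrow> nat \<times> nat" where
  "ray v n =
     (if v \<in> V \<and> same v then shear_snd (ray (\<sigma> v) n)
      else case n of 0 \<Rightarrow> (0, 1) | Suc k \<Rightarrow> shear_fst (ray (\<sigma> v) k))"
  by pat_completeness auto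
termination
proof (relation "inv_image (less_than <*lex*> {(\<sigma> v, v) | v. v \<in> V \<and> same v}) (\<lambda>(v, n). (n, v))")
  show "wf (inv_image (less_than <*lex*> {(\<sigma> v, v) | v. v \<in> V \<and> same v}) (\<lambda>(v, n). (n, v)))"
    using wf_same by blast
qed auto

declare ray.simps [simp del]

lemma ray_same: "v \<in> V \<Longrightarrow> same v \<Longrightarrow> ray v n = shear_snd (ray (\<sigma> v) n)"
  by (subst ray.simps) simp

lemma ray_other: "\<not> same v \<Longrightarrow> ray v (Suc n) = shear_fst (ray (\<sigma> v) n)"
  by (subst ray.simps) simp

lemma ray_0: "ray v 0 = (0, 1)"
  using wf_same
proof (induction v rule: wf_induct_rule)
  case (less v)
  then show ?case
    by (cases "v \<in> V \<and> same v") (auto simp: ray.simps[of v] shear_snd_def)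
qed

text \<open>
  Consecutive vectors have determinant \<open>-1\<close>: the shears preserve the determinant, and the
  recursion ends at \<open>(0, 1)\<close> followed by \<open>(1, 1)\<close>. The negative term is moved to the other side
  to stay within \<open>\<nat>\<close>.
\<close>
lemma ray_det:
  assumes "v \<in> V"
  shows "fst (ray v (Suc n)) * snd (ray v n) = fst (ray v n) * snd (ray v (Suc n)) + 1"
  using assms
proof (induction v n rule: ray.induct)
  case (1 v n)
  show ?case
  proof (cases "same v")
    case True
    then show ?thesis
      using 1 \<sigma>_closed by (simp add: ray_same algebra_simps)
  next
    case False
    then show ?thesis
      using 1 \<sigma>_closed
      by (cases n) (simp_all add: ray_other ray_0 algebra_simps)
  qed
qed

text \<open>
  All coordinates of all vectors as one indexed family, so that they can serve as the unknowns
  of a linear system.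
\<close>
definition coord :: "'v \<times> bool \<Rightarrow> nat \<Rightarrow> nat" where
  "coord p n = (if snd p then fst (ray (fst p) n) else snd (ray (fst p) n))"

abbreviation coord_index :: "('v \<times> bool) set" where
  "coord_index \<equiv> V \<times> UNIV"

lemma fst_ray_comb: "v \<in> V \<Longrightarrow> (\<lambda>n. fst (ray v n)) \<in> nat_combs coord_index coord"
  using nat_combs_base[of coord_index "(v, True)" coord] finite_V
  by (simp add: coord_def[abs_def] finite_cartesian_product)

lemma snd_ray_comb: "v \<in> V \<Longrightarrow> (\<lambda>n. snd (ray v n)) \<in> nat_combs coord_index coord"
  using nat_combs_base[of coord_index "(v, False)" coord] finite_V
  by (simp add: coord_def[abs_def] finite_cartesian_product)

text \<open>
  Index-keeping steps express the vector at index \<open>n + 1\<close> by the one at \<open>\<sigma> v\<close>, still at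
  index \<open>n + 1\<close>; by well-foundedness an index-lowering step is reached, after which only values
  at index \<open>n\<close> occur.
\<close>
lemma ray_Suc_comb:
  assumes "v \<in> V"
  shows "(\<lambda>n. fst (ray v (Suc n))) \<in> nat_combs coord_index coord \<and>
         (\<lambda>n. snd (ray v (Suc n))) \<in> nat_combs coord_index coord"
  using wf_same assms
proof (induction v rule: wf_induct_rule)
  case (less v)
  then have \<sigma>v: "\<sigma> v \<in> V"
    by (simp add: \<sigma>_closed)
  show ?case
  proof (cases "same v")
    case True
    then show ?thesis
      using less \<sigma>v by (auto simp: ray_same intro!: nat_combs_add)
  next
    case False
    then show ?thesis
      using \<sigma>v by (auto simp: ray_other intro!: nat_combs_add fst_ray_comb snd_ray_comb)
  qed
qed

lemma coord_Suc_comb: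
  "p \<in> coord_index \<Longrightarrow> (\<lambda>n. coord p (Suc n)) \<in> nat_combs coord_index coord"
  using ray_Suc_comb[of "fst p"] by (cases "snd p") (auto simp: coord_def)

end

section \<open>The frieze of an oriented cycle as a pairing of shear recursions\<close>

definition cyc_prev :: "nat \<Rightarrow> nat \<Rightarrow> nat" where
  "cyc_prev m i = (i + m) mod (m + 1)"

definition cyc_next :: "nat \<Rightarrow> nat \<Rightarrow> nat" where
  "cyc_next m i = (i + 1) mod (m + 1)"

lemma cyc_closed: "cyc_prev m i \<in> {0..m}" "cyc_next m i \<in> {0..m}"
  by (simp_all add: cyc_prev_def cyc_next_def less_Suc_eq_le[symmetric])

lemma cyc_inverse:
  assumes "i \<in> {0..m}"
  shows "cyc_prev m (cyc_next m i) = i" "cyc_next m (cyc_prev m i) = i"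
proof -
  have "Suc (i + m) mod Suc m = i"
    using assms mod_add_self2[of i "Suc m"] by simp
  then show "cyc_prev m (cyc_next m i) = i" "cyc_next m (cyc_prev m i) = i"
    by (simp_all add: cyc_prev_def cyc_next_def mod_simps)
qed

text \<open>
  Here \<open>fwd i\<close> says that the arrow between \<open>i\<close> and its successor points to the successor.
  The two assumptions are acyclicity in the form in which the two recursions use it: neither the
  forward nor the backward edges fill the whole cycle.
\<close>
locale oriented_cycle =
  fixes m :: nat and fwd :: "nat \<Rightarrow> bool"
  assumes wf_prev: "wf {(cyc_prev m i, i) | i. i \<in> {0..m} \<and> fwd (cyc_prev m i)}"
    and wf_next: "wf {(cyc_next m i, i) | i. i \<in> {0..m} \<and> \<not> fwd i}"
begin

abbreviation "prv \<equiv> cyc_prev m"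
abbreviation "nxt \<equiv> cyc_next m"

sublocale L: shear_recursion "{0..m}" prv "\<lambda>i. fwd (prv i)"
  using wf_prev cyc_closed by unfold_locales auto

sublocale R: shear_recursion "{0..m}" nxt "\<lambda>i. \<not> fwd i"
  using wf_next cyc_closed by unfold_locales auto

text \<open>
  The two indices vary independently because the two factors in the frieze rule turn
  out to be the pairings at \<open>i\<close> whose indices differ by one; the frieze itself is the diagonal \<open>k = n\<close>.
\<close>
definition pairing :: "nat \<Rightarrow> nat \<Rightarrow> nat \<Rightarrow> nat" where
  "pairing i k n = fst (L.ray i k) * fst (R.ray i n) + snd (L.ray i k) * snd (R.ray i n)"

lemma pairing_0: "pairing i 0 0 = 1"
  by (simp add: pairing_def L.ray_0 R.ray_0)

text \<open>
  Crossing an edge does not change the product of the matrices; it only moves the matrix of that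
  edge from \<open>R\<close> to \<open>L\<close>. A forward edge counts towards the index of \<open>R\<close>, a backward edge
  towards that of \<open>L\<close>.
\<close>
lemma pairing_fwd:
  assumes "i \<in> {0..m}" "fwd i"
  shows "pairing i k (Suc n) = pairing (nxt i) k n"
  using assms R.\<sigma>_closed[of i] R.ray_other[of i n] L.ray_same[of "nxt i" k]
  by (simp add: pairing_def cyc_inverse algebra_simps)

lemma pairing_not_fwd:
  assumes "i \<in> {0..m}" "\<not> fwd i"
  shows "pairing i k n = pairing (nxt i) (Suc k) n"
  using assms R.\<sigma>_closed[of i] R.ray_same[of i n] L.ray_other[of "nxt i" k]
  by (simp add: pairing_def cyc_inverse algebra_simps)

text \<open>
  The determinant of the four pairings is the product of the determinants of the pairs of left
  and of right vectors, that is \<open>(-1) \<cdot> (-1)\<close>.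
\<close>
lemma pairing_unimodular:
  assumes i: "i \<in> {0..m}"
  shows "pairing i (Suc n) (Suc n) * pairing i n n =
         1 + pairing i (Suc n) n * pairing i n (Suc n)"
proof -
  have binet: "(l1 * r1 + l2 * r2) * (p1 * q1 + p2 * q2) =
      1 + (l1 * q1 + l2 * q2) * (p1 * r1 + p2 * r2)"
    if "l1 * p2 = p1 * l2 + 1" "r1 * q2 = q1 * r2 + 1" for l1 l2 p1 p2 r1 r2 q1 q2 :: int
  proof -
    have minors: "(l1 * r1 + l2 * r2) * (p1 * q1 + p2 * q2)
        - (l1 * q1 + l2 * q2) * (p1 * r1 + p2 * r2) =
        (l1 * p2 - p1 * l2) * (r1 * q2 - q1 * r2)"
      by (simp add: algebra_simps)
    have "l1 * p2 - p1 * l2 = 1" "r1 * q2 - q1 * r2 = 1"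
      using that by linarith+
    with minors show ?thesis
      by (simp only: diff_eq_eq mult_1_left)
  qed
  have "int (pairing i (Suc n) (Suc n) * pairing i n n) =
      int (1 + pairing i (Suc n) n * pairing i n (Suc n))"
    unfolding pairing_def of_nat_add of_nat_mult of_nat_1
    by (rule binet)
      (use L.ray_det[OF i, of n, THEN arg_cong[of _ _ int]]
           R.ray_det[OF i, of n, THEN arg_cong[of _ _ int]] in simp_all)
  then show ?thesis
    by (simp only: of_nat_eq_iff)
qed

definition diag :: "nat \<Rightarrow> nat \<Rightarrow> nat" where
  "diag i n = pairing i n n"

lemma diag_recurrence:
  assumes i: "i \<in> {0..m}"
  shows "diag i (Suc n) * diag i n =
    1 + (if fwd (prv i) then diag (prv i) (Suc n) else diag (prv i) n) *
        (if fwd i then diag (nxt i) n else diag (nxt i) (Suc n))"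
proof -
  have "pairing i (Suc n) n = (if fwd (prv i) then diag (prv i) (Suc n) else diag (prv i) n)"
    using pairing_fwd[of "prv i"] pairing_not_fwd[of "prv i"] i L.\<sigma>_closed[of i]
    by (simp add: diag_def cyc_inverse)
  moreover have "pairing i n (Suc n) = (if fwd i then diag (nxt i) n else diag (nxt i) (Suc n))"
    using pairing_fwd[of i] pairing_not_fwd[of i] i
    by (simp add: diag_def)
  ultimately show ?thesis
    using pairing_unimodular[OF i, of n] by (simp only: diag_def)
qed

lemma diag_pos: "i \<in> {0..m} \<Longrightarrow> diag i n > 0"
  using diag_recurrence[of i n] by (cases "diag i n") auto

text \<open>
  The linear system consists of all products of a coordinate of a left vector with a coordinate
  of a right vector, at any two vertices.
\<close>
lemma N_rational_diag:
  assumes i: "i \<in> {0..m}"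
  shows "N_rational (diag i)"
proof (rule N_rational_linear_system)
  let ?I = "L.coord_index \<times> R.coord_index"
  let ?B = "\<lambda>(p, q) n. L.coord p n * R.coord q n"
  show "finite ?I"
    by (simp add: finite_cartesian_product)
  show "?I \<noteq> {}"
    using i by auto
  show "(\<lambda>n. ?B pq (Suc n)) \<in> nat_combs ?I ?B" if "pq \<in> ?I" for pq
    using that nat_combs_mult[OF L.coord_Suc_comb R.coord_Suc_comb] by (cases pq) auto
  have "diag i = (\<lambda>n. fst (L.ray i n) * fst (R.ray i n) + snd (L.ray i n) * snd (R.ray i n))"
    by (simp add: diag_def pairing_def fun_eq_iff)
  then show "diag i \<in> nat_combs ?I ?B"
    using i by (auto intro!: nat_combs_add nat_combs_mult
        L.fst_ray_comb L.snd_ray_comb R.fst_ray_comb R.snd_ray_comb)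
qed

end

section \<open>The frieze of a quiver whose underlying graph is a cycle\<close>

text \<open>
  What remains is to recognise the recurrence of \<open>diag\<close> as the frieze rule along the given
  enumeration of the cycle; positivity of \<open>diag\<close> permits the division in the rule.
\<close>
theorem theorem10p1:
  fixes Q :: "('v, 'e) pre_digraph" and m :: nat
  assumes "m \<ge> 1"
    and "acyclic_quiver Q"
    and "underlying_A_tilde m Q"
  shows "\<forall>v\<in>verts Q. \<exists>a :: nat \<Rightarrow> nat.
           (\<forall>n. acyclic_quiver.frieze Q v n = of_nat (a n)) \<and> N_rational a"
proof -
  interpret acyclic_quiver Q by fact
  let ?prv = "cyc_prev m" and ?nxt = "cyc_next m"
  obtain \<phi> \<psi> where \<phi>: "bij_betw \<phi> {0..m} (verts Q)" and \<psi>: "bij_betw \<psi> {0..m} (arcs Q)"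
    and ends: "\<And>i. i \<in> {0..m} \<Longrightarrow>
      {tail Q (\<psi> i), head Q (\<psi> i)} = {\<phi> i, \<phi> ((i + 1) mod (m + 1))}"
    using assms(3) by (auto simp: underlying_A_tilde_def)
  define fwd where "fwd i \<longleftrightarrow> tail Q (\<psi> i) = \<phi> i" for i
  note closed = cyc_closed[of m]
  note prv_nxt = cyc_inverse(1)[of _ m] and nxt_prv = cyc_inverse(2)[of _ m]
  have \<phi>_eq: "\<phi> i = \<phi> j \<longleftrightarrow> i = j" if "i \<in> {0..m}" "j \<in> {0..m}" for i j
    using \<phi> that by (auto simp: bij_betw_def inj_on_def)
  have \<psi>_arc: "\<psi> i \<in> arcs Q" if "i \<in> {0..m}" for i
    using \<psi> that by (auto simp: bij_betw_def)
  have nxt_neq: "?nxt i \<noteq> i" if "i \<in> {0..m}" for i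
    using that assms(1) by (auto simp: cyc_next_def mod_Suc)
  have fwd_ends: "tail Q (\<psi> i) = \<phi> i" "head Q (\<psi> i) = \<phi> (?nxt i)"
    if "i \<in> {0..m}" "fwd i" for i
    using ends[of i] that by (auto simp: fwd_def cyc_next_def doubleton_eq_iff)
  have bwd_ends: "tail Q (\<psi> i) = \<phi> (?nxt i)" "head Q (\<psi> i) = \<phi> i"
    if "i \<in> {0..m}" "\<not> fwd i" for i
    using ends[of i] that by (auto simp: fwd_def cyc_next_def doubleton_eq_iff)
  have wf_pull: "wf (inv_image (arcs_ends Q) \<phi>)"
    using wf_arcs_ends by blast
  interpret C: oriented_cycle m fwd
  proof unfold_locales
    show "wf {(?prv i, i) | i. i \<in> {0..m} \<and> fwd (?prv i)}"
    proof (rule wf_subset[OF wf_pull], rule subsetI, elim CollectE exE conjE, hypsubst)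
      fix i assume "i \<in> {0..m}" "fwd (?prv i)"
      then show "(?prv i, i) \<in> inv_image (arcs_ends Q) \<phi>"
        using fwd_ends[of "?prv i"] closed(1) \<psi>_arc[of "?prv i"] nxt_prv[of i]
        by (force simp: arcs_ends_conv)
    qed
    show "wf {(?nxt i, i) | i. i \<in> {0..m} \<and> \<not> fwd i}"
    proof (rule wf_subset[OF wf_pull], rule subsetI, elim CollectE exE conjE, hypsubst)
      fix i assume "i \<in> {0..m}" "\<not> fwd i"
      then show "(?nxt i, i) \<in> inv_image (arcs_ends Q) \<phi>"
        using bwd_ends[of i] \<psi>_arc[of i] by (force simp: arcs_ends_conv)
    qed
  qed
  \<comment> \<open>Both products in the frieze rule together have exactly two factors, one for each of the
    two edges of the cycle at \<open>\<phi> i\<close>; the factor depends only on the direction of the edge.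
    For \<open>m = 1\<close> the two edges join the same vertices, so it is edges that have to be counted.\<close>
  have neighbours: "(\<Prod>e\<in>in_arcs Q (\<phi> i). x (tail Q e)) * (\<Prod>e\<in>out_arcs Q (\<phi> i). y (head Q e)) =
      (if fwd (?prv i) then x (\<phi> (?prv i)) else y (\<phi> (?prv i))) *
      (if fwd i then y (\<phi> (?nxt i)) else x (\<phi> (?nxt i)))"
    if i: "i \<in> {0..m}" for i and x y :: "'v \<Rightarrow> rat"
  proof -
    define g where "g e = (if head Q e = \<phi> i then x (tail Q e) else y (head Q e))" for e
    have no_loop: "head Q e \<noteq> tail Q e" if "e \<in> arcs Q" for e
      using that wf_not_refl[OF wf_arcs_ends, of "tail Q e"] by (force simp: arcs_ends_conv)
    have prv_neq: "?prv i \<noteq> i"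
      using nxt_prv[OF i] nxt_neq[OF i] by auto
    have "(\<Prod>e\<in>in_arcs Q (\<phi> i). x (tail Q e)) * (\<Prod>e\<in>out_arcs Q (\<phi> i). y (head Q e)) =
        (\<Prod>e\<in>in_arcs Q (\<phi> i). g e) * (\<Prod>e\<in>out_arcs Q (\<phi> i). g e)"
      by (intro arg_cong2[where f = "(*)"] prod.cong) (auto simp: g_def dest: no_loop)
    also have "\<dots> = (\<Prod>e\<in>in_arcs Q (\<phi> i) \<union> out_arcs Q (\<phi> i). g e)"
      by (rule prod.union_disjoint[symmetric]) (use no_loop in \<open>auto, metis\<close>)
    also have "in_arcs Q (\<phi> i) \<union> out_arcs Q (\<phi> i) = \<psi> ` {j \<in> {0..m}. j = i \<or> ?nxt j = i}"
    proof -
      have "arcs Q = \<psi> ` {0..m}"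
        using \<psi> by (simp add: bij_betw_def)
      then have "in_arcs Q (\<phi> i) \<union> out_arcs Q (\<phi> i) =
          \<psi> ` {j \<in> {0..m}. head Q (\<psi> j) = \<phi> i \<or> tail Q (\<psi> j) = \<phi> i}"
        by (auto simp: in_arcs_def out_arcs_def)
      moreover have "head Q (\<psi> j) = \<phi> i \<or> tail Q (\<psi> j) = \<phi> i \<longleftrightarrow> j = i \<or> ?nxt j = i"
        if "j \<in> {0..m}" for j
        using fwd_ends[OF that] bwd_ends[OF that] \<phi>_eq[OF that i] \<phi>_eq[OF closed(2)[of j] i]
        by (cases "fwd j") auto
      ultimately show ?thesis
        by (simp cong: conj_cong)
    qed
    also have "{j \<in> {0..m}. j = i \<or> ?nxt j = i} = {?prv i, i}"
      using i closed(1)[of i] nxt_prv[OF i] by (auto simp: prv_nxt)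
    also have "(\<Prod>e\<in>\<psi> ` {?prv i, i}. g e) = g (\<psi> (?prv i)) * g (\<psi> i)"
    proof -
      have "\<psi> (?prv i) \<noteq> \<psi> i"
        using prv_neq \<psi> i closed by (auto simp: bij_betw_def inj_on_def)
      then show ?thesis by simp
    qed
    also have "g (\<psi> (?prv i)) =
        (if fwd (?prv i) then x (\<phi> (?prv i)) else y (\<phi> (?prv i)))"
      using fwd_ends[OF closed(1)[of i]] bwd_ends[OF closed(1)[of i]]
        nxt_prv[OF i] prv_neq \<phi>_eq[OF closed(1)[of i] i]
      by (cases "fwd (?prv i)") (simp_all add: g_def)
    also have "g (\<psi> i) = (if fwd i then y (\<phi> (?nxt i)) else x (\<phi> (?nxt i)))"
      using fwd_ends[OF i] bwd_ends[OF i] nxt_neq[OF i] \<phi>_eq[OF closed(2)[of i] i]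
      by (cases "fwd i") (simp_all add: g_def)
    finally show ?thesis .
  qed
  \<comment> \<open>Rewriting with the frieze rule does not end, since its right-hand side again
    contains values at \<open>n + 1\<close>.\<close>
  note frieze.simps(2) [simp del]
  have frieze_diag: "frieze (\<phi> i) n = of_nat (C.diag i n)" if "i \<in> {0..m}" for i n
    using that
  proof (induction "\<phi> i" n arbitrary: i rule: frieze.induct)
    case 1
    then show ?case by (simp add: C.diag_def C.pairing_0)
  next
    case (2 n)
    have below: "frieze (\<phi> i) n = of_nat (C.diag i n)"
      using 2 by blast
    have into: "frieze (\<phi> j) (Suc n) = of_nat (C.diag j (Suc n))"
      if "j \<in> {0..m}" "e \<in> arcs Q" "tail Q e = \<phi> j" "head Q e = \<phi> i" for e j
      using 2(1)[of e j] that by (simp add: in_arcs_def)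
    have out: "frieze (\<phi> j) n = of_nat (C.diag j n)"
      if "j \<in> {0..m}" "e \<in> arcs Q" "tail Q e = \<phi> i" "head Q e = \<phi> j" for e j
      using 2(2)[of e j] that by (simp add: out_arcs_def)
    have left: "(if fwd (?prv i) then frieze (\<phi> (?prv i)) (Suc n)
        else frieze (\<phi> (?prv i)) n) =
        of_nat (if fwd (?prv i) then C.diag (?prv i) (Suc n) else C.diag (?prv i) n)"
      using into[OF closed(1) \<psi>_arc[OF closed(1)], of i i] fwd_ends[OF closed(1), of i]
        out[OF closed(1) \<psi>_arc[OF closed(1)], of i i] bwd_ends[OF closed(1), of i]
        nxt_prv[OF 2(4)]
      by (cases "fwd (?prv i)") simp_all
    have right: "(if fwd i then frieze (\<phi> (?nxt i)) n else frieze (\<phi> (?nxt i)) (Suc n)) =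
        of_nat (if fwd i then C.diag (?nxt i) n else C.diag (?nxt i) (Suc n))"
      using out[OF closed(2) \<psi>_arc[OF 2(4)], of i] fwd_ends[OF 2(4)]
        into[OF closed(2) \<psi>_arc[OF 2(4)], of i] bwd_ends[OF 2(4)]
      by (cases "fwd i") simp_all
    have "frieze (\<phi> i) (Suc n) = of_nat (C.diag i (Suc n) * C.diag i n) / frieze (\<phi> i) n"
      using neighbours[OF 2(4), of "\<lambda>v. frieze v (Suc n)" "\<lambda>v. frieze v n"]
      by (simp only: frieze.simps(2)[of "\<phi> i" n] left right C.diag_recurrence[OF 2(4)]
          of_nat_add of_nat_mult of_nat_1)
    then show ?case
      using C.diag_pos[OF 2(4), of n] by (simp add: below)
  qed
  show ?thesis
  proof
    fix v assume "v \<in> verts Q"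
    then obtain i where "i \<in> {0..m}" "v = \<phi> i"
      using \<phi> unfolding bij_betw_def by blast
    then show "\<exists>a :: nat \<Rightarrow> nat. (\<forall>n. frieze v n = of_nat (a n)) \<and> N_rational a"
      using frieze_diag C.N_rational_diag by blast
  qed
qed

end
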